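(* Let $S=\langle T\rangle$ be a free numerical semigroup generated by a telescopic sequence $T=(t_0,\dots,t_k)$ (with $\gcd(T)=1$). Let $c(T)=(c_1,\dots,c_k)$, and let $c_0=1$. Let $m=\min\{0\le i\le k : t_i\text{ is odd}\}$ and $I=\{0\le i\le k : t_i\text{ is even}\}$. Then \[ O(G(S))-E(G(S)) = -\frac{1}{2}+\frac{c_m t_m}{2t_0}\prod_{i\in I}c_i . \] In particular, if $t_0$ is odd, then \[ O(G(S))-E(G(S)) = -\frac{1}{2}+\frac{1}{2}\prod_{i\in I}c_i . \]
   Context: $\mathbb{N}_0$ denotes the set of nonnegative integers. A numerical semigroup $S$ is a submonoid of $(\mathbb{N}_0,+)$ with finite complement; $G(S)=\mathbb{N}_0\setminus S$ is its (finite) set of gaps. For positive integers $n_1,\dots,n_r$, $\langle n_1,\dots,n_r\rangle$ is the set of all $\mathbb{N}_0$-linear combinations of $n_1,\dots,n_r$; it is a numerical semigroup iff $\gcd(n_1,\dots,n_r)=1$. Telescopic sequence: let $k\in\mathbb{N}_0$ and let $T=(t_0,\dots,t_k)$ be a sequence of positive integers. For $0\le i\le k$ let $T_i=(t_0,\dots,t_i)$ and $d_i=\gcd(T_i)=\gcd(t_0,\dots,t_i)$. For $1\le j\le k$ let $c_j=d_{j-1}/d_j$, and set $c(T)=(c_1,\dots,c_k)$. $T$ is telescopic if $c_jt_j\in\langle T_{j-1}\rangle=\langle t_0,\dots,t_{j-1}\rangle$ for all $j=1,\dots,k$. If $T$ is telescopic and $\gcd(T)=1$, then $\langle T\rangle$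 is called a free numerical semigroup. For a finite set $X$ of integers, $O(X)$ (resp. $E(X)$) is the number of odd (resp. even) integers in $X$. The empty product is $1$. The identities are between rational numbers. *)

theory Defs
  imports Complex_Main
begin

(* A finite sequence T = (t_0,...,t_k) is given by a function t :: nat => nat together
   with its last index k; the values of t beyond k are irrelevant. *)

definition generated :: "(nat \<Rightarrow> nat) \<Rightarrow> nat \<Rightarrow> nat set" where
  "generated t i = {\<Sum>j\<le>i. a j * t j | a :: nat \<Rightarrow> nat. True}"

definition gcd_upto :: "(nat \<Rightarrow> nat) \<Rightarrow> nat \<Rightarrow> nat" where
  "gcd_upto t i = Gcd (t ` {..i})"

(* The division is exact, because gcd_upto t j divides gcd_upto t (j - 1).
   The value at 0 is the convention c_0 = 1. *)
definition tele_c :: "(nat \<Rightarrow> nat) \<Rightarrow> nat \<Rightarrow> nat" where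
  "tele_c t j = (if j = 0 then 1 else gcd_upto t (j - 1) div gcd_upto t j)"

definition telescopic :: "(nat \<Rightarrow> nat) \<Rightarrow> nat \<Rightarrow> bool" where
  "telescopic t k \<longleftrightarrow>
     (\<forall>i\<le>k. t i > 0) \<and> (\<forall>j\<in>{1..k}. tele_c t j * t j \<in> generated t (j - 1))"

definition gaps :: "nat set \<Rightarrow> nat set" where
  "gaps S = UNIV - S"

definition num_odd :: "'a :: semiring_parity set \<Rightarrow> nat" where
  "num_odd X = card {x \<in> X. odd x}"

definition num_even :: "'a :: semiring_parity set \<Rightarrow> nat" where
  "num_even X = card {x \<in> X. even x}"

end

theory Submission
  imports Defs "HOL-Analysis.Infinite_Sum" "HOL-Number_Theory.Cong"
begin

text \<open>
  In a telescopic sequence every element of \<open>\<langle>T\<^sub>j\<rangle>\<close> is uniquely \<open>s + a t\<^sub>j\<close> with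
  \<open>s \<in> \<langle>T\<^sub>j\<^sub>-\<^sub>1\<rangle>\<close> and \<open>a < c\<^sub>j\<close>, so that for \<open>\<bar>x\<bar> < 1\<close> the Hilbert series of \<open>S\<close> is
  \<open>1 / (1 - x^t\<^sub>0)\<close> times the product of the \<open>(1 - x^(c\<^sub>j t\<^sub>j)) / (1 - x^t\<^sub>j)\<close>.
  It equals \<open>1 / (1 - x)\<close> minus the gap polynomial, whose value at \<open>-1\<close> is the number of even
  gaps minus the number of odd ones. This value is computed as the limit for \<open>x\<close> tending to \<open>-1\<close>:
  the factors with even \<open>t\<^sub>j\<close> tend to \<open>c\<^sub>j\<close>; for odd \<open>t\<^sub>j\<close> with \<open>j \<noteq> m\<close> the number \<open>c\<^sub>j\<close> is odd and the
  factor tends to \<open>1\<close>; the remaining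
  \<open>(1 - x^(c\<^sub>m t\<^sub>m)) / (1 - x^t\<^sub>0) \<cdot> 1 / (1 - x^t\<^sub>m)\<close> tends to \<open>c\<^sub>m t\<^sub>m / t\<^sub>0 \<cdot> 1 / 2\<close>.
\<close>

section \<open>Semigroups generated by initial segments\<close>

lemma generated_0: "n \<in> generated t 0 \<longleftrightarrow> (\<exists>a. n = a * t 0)"
proof
  assume "\<exists>a. n = a * t 0"
  then obtain a where "n = a * t 0" ..
  then show "n \<in> generated t 0"
    unfolding generated_def by (auto intro!: exI[of _ "\<lambda>_. a"])
qed (auto simp: generated_def)

lemma generated_Suc:
  "n \<in> generated t (Suc i) \<longleftrightarrow> (\<exists>s\<in>generated t i. \<exists>a. n = s + a * t (Suc i))"
proof
  assume "\<exists>s\<in>generated t i. \<exists>a. n = s + a * t (Suc i)"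
  then obtain b a where "n = (\<Sum>j\<le>i. b j * t j) + a * t (Suc i)"
    by (auto simp: generated_def)
  moreover have "(\<Sum>j\<le>i. (b(Suc i := a)) j * t j) = (\<Sum>j\<le>i. b j * t j)"
    by (intro sum.cong) auto
  ultimately have "n = (\<Sum>j\<le>Suc i. (b(Suc i := a)) j * t j)" by simp
  then show "n \<in> generated t (Suc i)" unfolding generated_def by blast
qed (auto simp: generated_def)

lemma generated_add:
  assumes "u \<in> generated t i" "v \<in> generated t i"
  shows "u + v \<in> generated t i"
proof -
  obtain a b where "u = (\<Sum>j\<le>i. a j * t j)" "v = (\<Sum>j\<le>i. b j * t j)"
    using assms by (auto simp: generated_def)
  then have "u + v = (\<Sum>j\<le>i. (a j + b j) * t j)"
    by (simp add: sum.distrib distrib_right)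
  then show ?thesis unfolding generated_def by (auto intro!: exI[of _ "\<lambda>j. a j + b j"])
qed

lemma zero_in_generated: "0 \<in> generated t i"
  unfolding generated_def by (auto intro!: exI[of _ "\<lambda>_. 0"])

lemma generated_mult: "u \<in> generated t i \<Longrightarrow> q * u \<in> generated t i"
  by (induction q) (auto intro: generated_add zero_in_generated)

lemma gcd_upto_Suc: "gcd_upto t (Suc i) = gcd (gcd_upto t i) (t (Suc i))"
  by (simp add: gcd_upto_def atMost_Suc gcd.commute)

lemma gcd_upto_dvd: "j \<le> i \<Longrightarrow> gcd_upto t i dvd t j"
  unfolding gcd_upto_def by (rule Gcd_dvd) auto

lemma gcd_upto_dvd_generated: "n \<in> generated t i \<Longrightarrow> gcd_upto t i dvd n"
  unfolding generated_def by (auto intro!: dvd_sum dvd_mult gcd_upto_dvd)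

lemma gcd_upto_pos: "t 0 > 0 \<Longrightarrow> gcd_upto t i > 0"
  using gcd_upto_dvd[of 0 i t] by (auto intro!: Nat.gr0I)

lemma tele_c_Suc_mult: "tele_c t (Suc i) * gcd_upto t (Suc i) = gcd_upto t i"
  by (simp add: tele_c_def gcd_upto_Suc)

lemma even_gcd_upto: "(\<And>j. j \<le> i \<Longrightarrow> even (t j)) \<Longrightarrow> even (gcd_upto t i)"
  unfolding gcd_upto_def by (rule Gcd_greatest) auto

text \<open>Induction on \<open>i\<close>, with the next generator solving a congruence: some
  multiple \<open>a * t (Suc i)\<close> agrees with \<open>n\<close> modulo
  \<open>gcd_upto t i\<close>, and for large \<open>n\<close> the difference falls under the
  induction hypothesis. With gcd 1 this makes the set of gaps finite.\<close>

lemma generated_eventually: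
  assumes "t 0 > 0"
  shows "\<exists>N. \<forall>n\<ge>N. gcd_upto t i dvd n \<longrightarrow> n \<in> generated t i"
proof (induction i)
  case 0
  show ?case by (auto simp: generated_0 gcd_upto_def elim!: dvdE)
next
  case (Suc i)
  then obtain N where N: "\<And>n. n \<ge> N \<Longrightarrow> gcd_upto t i dvd n \<Longrightarrow> n \<in> generated t i" by blast
  let ?D = "gcd_upto t i" and ?u = "t (Suc i)"
  have D: "?D > 0" using assms by (rule gcd_upto_pos)
  have "n \<in> generated t (Suc i)"
    if n: "n \<ge> N + ?D * ?u" and dvd: "gcd_upto t (Suc i) dvd n" for n
  proof -
    obtain q where q: "n = gcd ?u ?D * q"
      using dvd by (auto simp: gcd_upto_Suc gcd.commute elim!: dvdE)
    obtain x where "[?u * x = gcd ?u ?D] (mod ?D)" using cong_solve_nat by blast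
    then have "[?u * x * q = n] (mod ?D)" unfolding q by (rule cong_scalar_right)
    \<comment> \<open>Reducing modulo \<open>?D\<close> bounds the subtracted multiple by
      \<open>?D * ?u\<close>, which is why the new threshold is \<open>N + ?D * ?u\<close>.\<close>
    moreover define a where "a = (x * q) mod ?D"
    ultimately have cong: "[a * ?u = n] (mod ?D)"
      unfolding cong_def a_def by (metis mod_mult_left_eq mult.assoc mult.commute)
    have "a < ?D" using D by (simp add: a_def)
    then have "a * ?u \<le> ?D * ?u" by simp
    then have le: "a * ?u \<le> n" and ge: "n - a * ?u \<ge> N" using n by linarith+
    have "?D dvd n - a * ?u" using cong le by (simp add: cong_altdef_nat cong_sym_eq)
    then have "n - a * ?u \<in> generated t i" using N ge by blast
    then show ?thesis using le unfolding generated_Suc by (metis le_add_diff_inverse2)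
  qed
  then show ?case by blast
qed

lemma finite_gaps_generated:
  assumes "t 0 > 0" "gcd_upto t k = 1"
  shows "finite (gaps (generated t k))"
proof -
  obtain N where "\<forall>n\<ge>N. n \<in> generated t k"
    using generated_eventually[where t = t and i = k] assms by auto
  then have "gaps (generated t k) \<subseteq> {..<N}" by (auto simp: gaps_def not_le[symmetric])
  then show ?thesis by (rule finite_subset) simp
qed

section \<open>The Hilbert series\<close>

text \<open>Surjectivity uses the telescopic condition: the quotient of a coefficient by
  \<open>tele_c t (Suc i)\<close> is absorbed into \<open>generated t i\<close>. Injectivity uses
  only divisibility: \<open>tele_c t (Suc i)\<close> is coprime to \<open>t (Suc i)\<close> divided
  by \<open>gcd_upto t (Suc i)\<close>.\<close>

lemma bij_betw_generated_Suc:
  assumes "t 0 > 0" "tele_c t (Suc i) * t (Suc i) \<in> generated t i"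
  shows "bij_betw (\<lambda>(a, s). s + a * t (Suc i))
           ({..<tele_c t (Suc i)} \<times> generated t i) (generated t (Suc i))"
proof (rule bij_betw_imageI)
  let ?c = "tele_c t (Suc i)" and ?d = "gcd_upto t (Suc i)" and ?D = "gcd_upto t i"
    and ?u = "t (Suc i)"
  have d: "?d > 0" and D: "?D > 0" using assms(1) by (auto intro: gcd_upto_pos)
  have cd: "?c * ?d = ?D" by (rule tele_c_Suc_mult)
  obtain w where w: "?u = w * ?d" using gcd_upto_dvd[of "Suc i" "Suc i" t] by (metis dvdE mult.commute order_refl)
  have "gcd (?c * ?d) (w * ?d) = ?d" using cd w by (metis gcd_upto_Suc)
  then have "gcd ?c w * ?d = ?d" by (simp add: gcd_mult_distrib_nat mult.commute)
  then have cop: "coprime ?c w" using d by (simp add: coprime_iff_gcd_eq_1)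
  \<comment> \<open>One inequality suffices, since the situation is symmetric in the two
    representations. If it failed, \<open>?c\<close> would divide \<open>a - a'\<close>, which lies
    strictly between 0 and \<open>?c\<close>.\<close>
  have le: "a \<le> a'" if "a < ?c" "a' < ?c" "s \<in> generated t i" "s' \<in> generated t i"
    "s + a * ?u = s' + a' * ?u" for a a' s s'
  proof (rule ccontr)
    assume "\<not> a \<le> a'"
    then have lt: "a' < a" by simp
    have "s' = s + (a - a') * ?u" using that(5) lt by (simp add: algebra_simps)
    moreover have "?D dvd s" "?D dvd s'" using that by (auto intro: gcd_upto_dvd_generated)
    ultimately have "?D dvd (a - a') * ?u" by (simp add: dvd_add_right_iff)
    then have "?c * ?d dvd (a - a') * w * ?d" by (simp add: cd mult.assoc flip: w)
    then have "?c dvd (a - a') * w" using d by simp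
    then have "?c dvd a - a'" using cop by (simp add: coprime_dvd_mult_left_iff)
    then show False using lt that(1) by (auto dest: dvd_imp_le)
  qed
  show "inj_on (\<lambda>(a, s). s + a * ?u) ({..<?c} \<times> generated t i)"
  proof (rule inj_onI, clarify)
    fix a s a' s'
    assume *: "a < ?c" "a' < ?c" "s \<in> generated t i" "s' \<in> generated t i"
      "s + a * ?u = s' + a' * ?u"
    then have "a = a'" using le[of a a' s s'] le[of a' a s' s] by simp
    then show "a = a' \<and> s = s'" using * by simp
  qed
  have "n \<in> (\<lambda>(a, s). s + a * ?u) ` ({..<?c} \<times> generated t i)"
    if n: "n \<in> generated t (Suc i)" for n
  proof -
    obtain s a where s: "s \<in> generated t i" "n = s + a * ?u"
      using n by (auto simp: generated_Suc)
    have c: "?c > 0" using cd D by (auto intro!: Nat.gr0I)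
    have "a * ?u = (a div ?c) * (?c * ?u) + (a mod ?c) * ?u"
      by (metis div_mult_mod_eq distrib_right mult.assoc)
    then have "n = (s + (a div ?c) * (?c * ?u)) + (a mod ?c) * ?u" using s by simp
    moreover have "s + (a div ?c) * (?c * ?u) \<in> generated t i"
      using s(1) generated_mult[OF assms(2)] by (rule generated_add)
    ultimately show ?thesis using c by (intro image_eqI[of _ _ "(a mod ?c, _)"]) auto
  qed
  then show "(\<lambda>(a, s). s + a * ?u) ` ({..<?c} \<times> generated t i) = generated t (Suc i)"
    by (fastforce simp: generated_Suc)
qed

text \<open>Only the second factor may be infinite, so the fibres over the points of
  \<open>A\<close> can be added one at a time, with no summability argument on the product.\<close>

lemma has_sum_finite_Times:
  fixes f :: "'a \<times> 'b \<Rightarrow> 'c :: topological_comm_monoid_add"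
  assumes "finite A" "\<And>a. a \<in> A \<Longrightarrow> ((\<lambda>b. f (a, b)) has_sum g a) B"
  shows "(f has_sum (\<Sum>a\<in>A. g a)) (A \<times> B)"
  using assms
proof (induction A rule: finite_induct)
  case (insert a A)
  have "(f has_sum g a) (Pair a ` B)"
    using insert.prems by (subst has_sum_reindex) (auto simp: inj_on_def o_def)
  then have "(f has_sum (g a + (\<Sum>a\<in>A. g a))) (Pair a ` B \<union> A \<times> B)"
    using insert by (intro has_sum_Un_disjoint insert.IH) auto
  moreover have "Pair a ` B \<union> A \<times> B = insert a A \<times> B" by auto
  ultimately show ?case using insert by simp
qed simp

lemma has_sum_geometric:
  fixes x :: real
  assumes "\<bar>x\<bar> < 1"
  shows "((\<lambda>n. x ^ n) has_sum (1 / (1 - x))) UNIV"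
  using assms
  by (intro norm_summable_imp_has_sum geometric_sums)
     (auto simp: power_abs intro!: summable_geometric)

text \<open>By the bijection above, \<open>generated t (Suc j)\<close> consists of
  \<open>tele_c t (Suc j)\<close> disjoint translates of \<open>generated t j\<close>, so each step
  multiplies the series by a finite geometric sum of ratio \<open>x ^ t (Suc j)\<close>.\<close>

lemma has_sum_generated:
  fixes x :: real
  assumes "telescopic t k" "\<bar>x\<bar> < 1" "j \<le> k"
  shows "((\<lambda>n. x ^ n) has_sum
           (1 / (1 - x ^ t 0) * (\<Prod>i\<in>{1..j}. (1 - x ^ (tele_c t i * t i)) / (1 - x ^ t i))))
           (generated t j)"
  using assms(3)
proof (induction j)
  case 0
  have t0: "t 0 > 0" using assms(1) by (simp add: telescopic_def)
  have "\<bar>x ^ t 0\<bar> < 1" using assms(2) t0 by (simp add: power_abs power_less_one_iff)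
  then have "((\<lambda>n. (x ^ t 0) ^ n) has_sum (1 / (1 - x ^ t 0))) UNIV"
    by (rule has_sum_geometric)
  moreover have "bij_betw (\<lambda>n. n * t 0) UNIV (generated t 0)"
    using t0 by (intro bij_betw_imageI) (auto simp: inj_on_def generated_0)
  ultimately have "((\<lambda>n. x ^ n) has_sum (1 / (1 - x ^ t 0))) (generated t 0)"
    by (subst has_sum_reindex_bij_betw[symmetric]) (auto simp: mult.commute simp flip: power_mult)
  then show ?case by simp
next
  case (Suc j)
  let ?H = "1 / (1 - x ^ t 0) * (\<Prod>i\<in>{1..j}. (1 - x ^ (tele_c t i * t i)) / (1 - x ^ t i))"
  let ?c = "tele_c t (Suc j)" and ?u = "t (Suc j)"
  have pos: "t 0 > 0" "?u > 0" using assms(1) Suc.prems by (auto simp: telescopic_def)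
  have "Suc j \<in> {1..k}" using Suc.prems by simp
  then have tel: "?c * ?u \<in> generated t j"
    using assms(1) unfolding telescopic_def by (metis diff_Suc_1)
  have IH: "((\<lambda>n. x ^ n) has_sum ?H) (generated t j)" using Suc by simp
  have "((\<lambda>(a, s). x ^ (s + a * ?u)) has_sum (\<Sum>a<?c. ?H * x ^ (a * ?u)))
          ({..<?c} \<times> generated t j)"
    using has_sum_cmult_left[OF IH]
    by (intro has_sum_finite_Times) (simp_all only: prod.case power_add finite_lessThan)
  then have "((\<lambda>n. x ^ n) has_sum (\<Sum>a<?c. ?H * x ^ (a * ?u))) (generated t (Suc j))"
    using bij_betw_generated_Suc[where t = t, OF pos(1) tel]
    by (subst has_sum_reindex_bij_betw[symmetric]) (auto simp: case_prod_unfold)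
  moreover have "(\<Sum>a<?c. ?H * x ^ (a * ?u)) = ?H * ((1 - x ^ (?c * ?u)) / (1 - x ^ ?u))"
  proof -
    have "\<bar>x ^ ?u\<bar> < 1" using assms(2) pos by (simp add: power_abs power_less_one_iff)
    then have ne: "x ^ ?u \<noteq> 1" by auto
    have "(\<Sum>a<?c. x ^ (a * ?u)) = (\<Sum>a<?c. (x ^ ?u) ^ a)"
      by (simp add: mult.commute flip: power_mult)
    also have "\<dots> = (1 - (x ^ ?u) ^ ?c) / (1 - x ^ ?u)"
      using ne by (simp add: sum_gp_strict)
    also have "(x ^ ?u) ^ ?c = x ^ (?c * ?u)"
      by (simp add: mult.commute flip: power_mult)
    finally show ?thesis by (simp only: sum_distrib_left[symmetric])
  qed
  ultimately show ?case by (simp add: mult.assoc)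
qed

lemma gap_polynomial:
  fixes x :: real
  assumes "telescopic t k" "gcd_upto t k = 1" "\<bar>x\<bar> < 1"
  shows "(\<Sum>g\<in>gaps (generated t k). x ^ g) = 1 / (1 - x) -
           1 / (1 - x ^ t 0) * (\<Prod>i\<in>{1..k}. (1 - x ^ (tele_c t i * t i)) / (1 - x ^ t i))"
    (is "?P = _ - ?H")
proof -
  have "finite (gaps (generated t k))"
    using assms by (intro finite_gaps_generated) (auto simp: telescopic_def)
  then have "((\<lambda>n. x ^ n) has_sum (?H + ?P)) (generated t k \<union> gaps (generated t k))"
    using assms by (intro has_sum_Un_disjoint has_sum_generated) (auto simp: gaps_def)
  moreover have "generated t k \<union> gaps (generated t k) = UNIV" by (auto simp: gaps_def)
  ultimately have "?H + ?P = 1 / (1 - x)"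
    using has_sum_geometric[OF assms(3)] has_sum_unique by metis
  then show ?thesis by simp
qed

section \<open>The limit at \<open>-1\<close>\<close>

text \<open>Numerator and denominator both vanish at -1. Divided by \<open>x + 1\<close> they become
  difference quotients, and for even \<open>n\<close> the derivative of \<open>1 - x ^ n\<close> at
  -1 is \<open>n\<close>. The limit is taken from the right, where the series converges.\<close>

lemma tendsto_power_quotient_even:
  fixes a b :: nat
  assumes "even a" "even b" "b > 0"
  shows "((\<lambda>x. (1 - x ^ a) / (1 - x ^ b)) \<longlongrightarrow> real a / real b) (at_right (-1))"
proof -
  have slope: "((\<lambda>x. (1 - x ^ n) / (x + 1)) \<longlongrightarrow> real n) (at_right (-1))" if "even n" for n
  proof (cases "n = 0")
    case False
    have "((\<lambda>x. 1 - x ^ n) has_real_derivative - (real n * (-1) ^ (n - 1))) (at (-1) within {-1<..})"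
      by (auto intro!: derivative_eq_intros)
    moreover have "- (real n * (-1) ^ (n - 1)) = real n" using False that by simp
    ultimately show ?thesis using that by (simp add: has_field_derivative_iff)
  qed simp
  have "((\<lambda>x. ((1 - x ^ a) / (x + 1)) / ((1 - x ^ b) / (x + 1))) \<longlongrightarrow> real a / real b)
          (at_right (-1))"
    using assms by (intro tendsto_divide slope) auto
  moreover have "eventually (\<lambda>x. ((1 - x ^ a) / (x + 1)) / ((1 - x ^ b) / (x + 1)) =
      (1 - x ^ a) / (1 - x ^ b)) (at_right (-1 :: real))"
    by (auto simp: eventually_at_filter)
  ultimately show ?thesis by (rule Lim_transform_eventually)
qed

lemma tendsto_power_quotient_odd:
  fixes a b :: nat
  assumes "odd a" "odd b"
  shows "((\<lambda>x. (1 - x ^ a) / (1 - x ^ b)) \<longlongrightarrow> (1 :: real)) (at_right (-1))"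
proof -
  have "((\<lambda>x. (1 - x ^ a) / (1 - x ^ b)) \<longlongrightarrow> (1 - (-1) ^ a) / (1 - (-1 :: real) ^ b)) (at_right (-1))"
    using assms by (intro tendsto_intros) auto
  then show ?thesis using assms by simp
qed

lemma sum_minus_one_power:
  assumes "finite X"
  shows "(\<Sum>g\<in>X. (-1 :: real) ^ g) = real (num_even X) - real (num_odd X)"
proof -
  have "(\<Sum>g\<in>X. (-1 :: real) ^ g) = (\<Sum>g\<in>X. of_bool (even g) - of_bool (odd g))"
    by (intro sum.cong) auto
  also have "\<dots> = real (num_even X) - real (num_odd X)"
    using assms
    by (simp add: sum_subtractf num_even_def num_odd_def of_bool_def sum.If_cases Int_def
        flip: sum.inter_filter)
  finally show ?thesis .
qed

text \<open>\<open>tele_c t i\<close> divides the gcd of all terms before \<open>t i\<close>, and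
  the odd number \<open>t m\<close> is one of these terms.\<close>

lemma odd_tele_c:
  assumes "odd (t m)" "m < i"
  shows "odd (tele_c t i)"
proof -
  obtain j where j: "i = Suc j" using assms(2) by (cases i) auto
  have "tele_c t i dvd gcd_upto t j" using tele_c_Suc_mult[of t j] j by (metis dvd_triv_left)
  also have "\<dots> dvd t m" using assms j by (intro gcd_upto_dvd) simp
  finally show ?thesis using assms(1) by (meson dvd_trans)
qed

lemma gap_parity_real:
  assumes tel: "telescopic t k" and gcd1: "gcd_upto t k = 1"
    and m: "m \<le> k" "odd (t m)" and least: "\<And>i. i < m \<Longrightarrow> even (t i)"
  shows "real (num_odd (gaps (generated t k))) - real (num_even (gaps (generated t k))) =
           - (1 / 2) + real (tele_c t m * t m) / (2 * real (t 0)) *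
             (\<Prod>i\<in>{i. i \<le> k \<and> even (t i)}. real (tele_c t i))"
proof -
  let ?G = "gaps (generated t k)" and ?c = "tele_c t"
  let ?F = "\<lambda>x i. (1 - x ^ (?c i * t i)) / (1 - x ^ t i) :: real"
  \<comment> \<open>The Hilbert series regrouped: the numerator of factor \<open>m\<close> is paired
    with \<open>1 - x ^ t 0\<close>, so that every group has a finite limit at -1.\<close>
  define H where
    "H = (\<lambda>x :: real. (1 - x ^ (?c m * t m)) / (1 - x ^ t 0) * (1 / (1 - x ^ t m)) * (\<Prod>i\<in>{..k}-{m}. ?F x i))"
  let ?f = "\<lambda>i. if even (t i) then real (?c i) else 1"
  let ?L = "real (?c m * t m) / real (t 0) * (1 / 2) * (\<Prod>i\<in>{..k}-{m}. ?f i)"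
  have pos: "t i > 0" if "i \<le> k" for i using tel that by (auto simp: telescopic_def)
  have fin: "finite ?G" using pos gcd1 by (intro finite_gaps_generated) auto

  have head: "((\<lambda>x. (1 - x ^ (?c m * t m)) / (1 - x ^ t 0)) \<longlongrightarrow> real (?c m * t m) / real (t 0))
      (at_right (-1))"
  proof (cases m)
    case 0
    then show ?thesis
      using tendsto_power_quotient_odd[of "t 0" "t 0"] m pos[of 0] by (simp add: tele_c_def)
  next
    case (Suc j)
    \<comment> \<open>The gcd turns from even to odd exactly at index \<open>m\<close>, so
      \<open>?c m\<close> is even. Both exponents of the head are then even.\<close>
    have "even (gcd_upto t j)" using least Suc by (intro even_gcd_upto) auto
    moreover have "odd (gcd_upto t m)" using m gcd_upto_dvd[of m m t] by (meson dvd_trans order_refl)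
    ultimately have "even (?c m)" using tele_c_Suc_mult[of t j] Suc by (metis even_mult_iff)
    then show ?thesis using least[of 0] Suc pos[of 0]
      by (intro tendsto_power_quotient_even) auto
  qed
  have "((\<lambda>x. 1 / (1 - x ^ t m)) \<longlongrightarrow> 1 / (1 - (-1 :: real) ^ t m)) (at_right (-1))"
    using m by (intro tendsto_intros) auto
  then have mid: "((\<lambda>x. 1 / (1 - x ^ t m)) \<longlongrightarrow> 1 / 2) (at_right (-1 :: real))"
    using m by simp
  have tail: "((\<lambda>x. ?F x i) \<longlongrightarrow> ?f i) (at_right (-1))" if i: "i \<in> {..k} - {m}" for i
  proof (cases "even (t i)")
    case True
    then show ?thesis using tendsto_power_quotient_even[of "?c i * t i" "t i"] pos[of i] i by simp
  next
    case False
    \<comment> \<open>By minimality of \<open>m\<close>, an odd term at an index other than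
      \<open>m\<close> comes later.\<close>
    then have "m < i" using least i by (metis DiffD2 insertI1 linorder_neqE_nat)
    then have "odd (?c i)" using m odd_tele_c by blast
    then show ?thesis using False by (auto intro: tendsto_power_quotient_odd)
  qed
  have "(H \<longlongrightarrow> ?L) (at_right (-1))"
    unfolding H_def by (intro tendsto_mult head mid tendsto_prod tail)
  then have "((\<lambda>x. 1 / (1 - x) - H x) \<longlongrightarrow> 1 / (1 - (-1)) - ?L) (at_right (-1))"
    by (intro tendsto_intros) auto
  moreover have "eventually (\<lambda>x. 1 / (1 - x) - H x = (\<Sum>g\<in>?G. x ^ g)) (at_right (-1))"
  proof -
    have "eventually (\<lambda>x. x \<in> {-1<..<0}) (at_right (-1 :: real))"
      by (rule eventually_at_right_real) simp
    then show ?thesis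
    proof (rule eventually_mono)
      fix x :: real
      assume "x \<in> {-1<..<0}"
      then have x: "\<bar>x\<bar> < 1" by auto
      have ne: "1 - x ^ t i \<noteq> 0" if "i \<le> k" for i
      proof -
        have "\<bar>x ^ t i\<bar> < 1" using x pos[OF that] by (simp add: power_abs power_less_one_iff)
        then show ?thesis by auto
      qed
      \<comment> \<open>The convention for \<open>tele_c t 0\<close> makes the factor at index 0
        equal to 1, so \<open>m = 0\<close> needs no separate treatment here.\<close>
      have "(\<Prod>i\<in>{1..k}. ?F x i) = (\<Prod>i\<in>{..k}. ?F x i)"
        using ne by (intro prod.mono_neutral_left) (auto simp: tele_c_def)
      also have "\<dots> = ?F x m * (\<Prod>i\<in>{..k}-{m}. ?F x i)"
        using m by (intro prod.remove) auto
      finally have "1 / (1 - x ^ t 0) * (\<Prod>i\<in>{1..k}. ?F x i) = H x"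
        unfolding H_def by simp
      then show "1 / (1 - x) - H x = (\<Sum>g\<in>?G. x ^ g)"
        using gap_polynomial[OF tel gcd1 x] by simp
    qed
  qed
  ultimately have "((\<lambda>x. \<Sum>g\<in>?G. x ^ g) \<longlongrightarrow> 1 / (1 - (-1)) - ?L) (at_right (-1))"
    by (rule Lim_transform_eventually)
  \<comment> \<open>The gap sum is a polynomial, so its limit is its value at -1, and this must
    agree with the limit just found.\<close>
  moreover have "((\<lambda>x. \<Sum>g\<in>?G. x ^ g) \<longlongrightarrow> (\<Sum>g\<in>?G. (-1 :: real) ^ g)) (at_right (-1))"
    by (intro tendsto_intros)
  ultimately have "(\<Sum>g\<in>?G. (-1) ^ g) = 1 / 2 - ?L"
    using tendsto_unique[OF trivial_limit_at_right_real] by fastforce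
  moreover have "(\<Prod>i\<in>{..k}-{m}. ?f i) = (\<Prod>i\<in>{i. i \<le> k \<and> even (t i)}. real (?c i))"
    using m by (intro prod.mono_neutral_cong_right) auto
  ultimately show ?thesis using sum_minus_one_power[OF fin] by simp
qed

theorem theorem3p5:
  fixes t :: "nat \<Rightarrow> nat" and k m :: nat and S I :: "nat set"
  assumes "telescopic t k"
    and "gcd_upto t k = 1"
    and "S = generated t k"
    and "m = Min {i. i \<le> k \<and> odd (t i)}"
    and "I = {i. i \<le> k \<and> even (t i)}"
  shows "(of_nat (num_odd (gaps S)) - of_nat (num_even (gaps S)) :: rat) =
           - (1 / 2) + of_nat (tele_c t m * t m) / (2 * of_nat (t 0)) * (\<Prod>i\<in>I. of_nat (tele_c t i))
       \<and> (odd (t 0) \<longrightarrow>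
           (of_nat (num_odd (gaps S)) - of_nat (num_even (gaps S)) :: rat) =
             - (1 / 2) + (1 / 2) * (\<Prod>i\<in>I. of_nat (tele_c t i)))"
proof -
  let ?X = "{i. i \<le> k \<and> odd (t i)}"
  \<comment> \<open>This ensures that \<open>Min\<close> picks an actual element: if all terms were
    even, so would be their gcd.\<close>
  have "?X \<noteq> {}"
  proof
    assume "?X = {}"
    then have "even (gcd_upto t k)" by (intro even_gcd_upto) auto
    then show False using assms(2) by simp
  qed
  then have "m \<in> ?X" unfolding assms(4) by (intro Min_in) auto
  then have m: "m \<le> k" "odd (t m)" by auto
  have least: "even (t i)" if "i < m" for i
    using that m Min_le[of ?X i] unfolding assms(4)[symmetric] by fastforce
  let ?l = "of_nat (num_odd (gaps S)) - of_nat (num_even (gaps S)) :: rat"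
  let ?r = "- (1 / 2) + of_nat (tele_c t m * t m) / (2 * of_nat (t 0)) *
              (\<Prod>i\<in>I. of_nat (tele_c t i)) :: rat"
  \<comment> \<open>The limit argument lives in the reals; injectivity of \<open>of_rat\<close>
    brings the identity back to the rationals.\<close>
  have "real_of_rat ?l = real_of_rat ?r"
    using gap_parity_real[OF assms(1,2) m least] assms(3,5)
    by (simp add: of_rat_diff of_rat_add of_rat_divide of_rat_mult of_rat_minus
        flip: of_nat_prod)
  then have eq: "?l = ?r" by (simp only: of_rat_eq_iff)
  moreover have "?l = - (1 / 2) + (1 / 2) * (\<Prod>i\<in>I. of_nat (tele_c t i))" if "odd (t 0)"
  proof -
    have "m = 0" using least[of 0] that by auto
    then show ?thesis using eq that by (simp add: tele_c_def odd_pos)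
  qed
  ultimately show ?thesis by blast
qed

end
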